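(* For every $\overline{h}>0$ and every $0<\lambda_2\le\lambda_N$ there exists $K\in\mathbb{R}^{1\times 2}$ such that, for every admissible sampling sequence $\{t_k\}_{k\in\mathbb{N}}$ with intervals in $(0,\overline{h})$ and every sequence of balanced weighted graphs $G_k$ on $N$ nodes ($k\in\mathbb{N}$), each having a spanning tree and such that all eigenvalues of its Laplacian other than the simple eigenvalue $0$ lie in $[\lambda_2,\lambda_N]$, the control law $$u_i(t)=K\sum_{j=1}^N w_{ij}^{(k)}\left(x_j(t_k)-x_i(t_k)\right),\qquad t\in[t_k,t_{k+1}),\ i=1,\dots,N,$$ where $(w_{ij}^{(k)})$ is the weighted adjacency matrix of $G_k$, solves the consensus problem asymptotically for the $N$ double integrator agents $\dot{x}_i(t)=Ax_i(t)+Bu_i(t)$, $i=1,\dots,N$, with $A=\begin{bmatrix}0&1\\0&0\end{bmatrix}$ and $B=\begin{bmatrix}0\\1\end{bmatrix}$.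
   Context: $\mathbb{N}$ denotes the nonnegative integers. Graphs: a graph $G=(V,E)$ with $V=\{v_1,\dots,v_N\}$, $E\subseteq V\times V$, is simple (no self-loops, no multiple edges). An edge $(v_i,v_j)\in E$ denotes information flow from agent $j$ to agent $i$. The weighted adjacency matrix $W=(w_{ij})\in\mathbb{R}^{N\times N}$ satisfies $w_{ij}>0$ if $(v_i,v_j)\in E$ and $w_{ij}=0$ otherwise. The graph is called balanced if $W=W^T$. The in-degree is $d_i=\sum_{j}w_{ij}$ and the Laplacian is $L=D-W$, $D=\operatorname{diag}\{d_i\}$. The graph has a spanning tree if a subset of its edges forms a directed tree on all of $V$ (for balanced graphs: the underlying undirected graph is connected); in that case $0$ is a simple eigenvalue of $L$. Sampling: an admissible sampling sequence is $0=t_0<t_1<\dots$ with $\lim_{k\to\infty}t_k=\infty$ and $h_k:=t_{k+1}-t_k\in(0,\overline{h})$ for all $k\in\mathbb{N}$. Consensus: $x_i(t)\in\mathbb{R}^2$ is the state and $u_i(t)\in\mathbb{R}$ the control input of agent $i$. The control inputs solve the consensus problem asymptotically if for all initial states $\lim_{t\to\infty}(x_i(t)-x_j(t))=0$ for all $i,j=1,\dots,N$. *)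

theory Defs
  imports "HOL-Analysis.Analysis"
begin

text \<open>
  The agents (vertices) are the elements of a finite type, so that the number \<open>N\<close> of agents is
  its cardinality. An edge \<open>(i, j)\<close> denotes information flow from agent \<open>j\<close> to agent \<open>i\<close>.
\<close>

definition simple_graph :: "('n \<times> 'n) set \<Rightarrow> bool" where
  "simple_graph E \<longleftrightarrow> (\<forall>i. (i, i) \<notin> E)"

definition weighted_adjacency :: "('n::finite \<times> 'n) set \<Rightarrow> real^'n^'n \<Rightarrow> bool" where
  "weighted_adjacency E W \<longleftrightarrow>
     (\<forall>i j. ((i, j) \<in> E \<longrightarrow> W $ i $ j > 0) \<and> ((i, j) \<notin> E \<longrightarrow> W $ i $ j = 0))"

definition balanced :: "real^'n^'n \<Rightarrow> bool" where
  "balanced W \<longleftrightarrow> W = transpose W"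

definition in_degree :: "real^'n^'n \<Rightarrow> 'n::finite \<Rightarrow> real" where
  "in_degree W i = (\<Sum>j\<in>UNIV. W $ i $ j)"

definition laplacian :: "real^'n^'n \<Rightarrow> real^'n^('n::finite)" where
  "laplacian W = (\<chi> i j. if i = j then in_degree W i else 0) - W"

text \<open>
  A directed tree on all vertices: information flows from the root \<open>r\<close> to every vertex, and every
  vertex other than the root has exactly one parent. Since edges point from the receiver to the
  sender, paths along \<open>T\<close> lead from a vertex to the root.
\<close>

definition directed_tree :: "('n \<times> 'n) set \<Rightarrow> 'n \<Rightarrow> bool" where
  "directed_tree T r \<longleftrightarrow>
     (\<forall>j. (r, j) \<notin> T) \<and> (\<forall>i. i \<noteq> r \<longrightarrow> (\<exists>!j. (i, j) \<in> T)) \<and> (\<forall>i. (i, r) \<in> T\<^sup>*)"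

definition has_spanning_tree :: "('n \<times> 'n) set \<Rightarrow> bool" where
  "has_spanning_tree E \<longleftrightarrow> (\<exists>T r. T \<subseteq> E \<and> directed_tree T r)"

text \<open>
  This is applied to symmetric real matrices only, all of whose complex eigenvalues are real.
\<close>

definition eigenvalue :: "'a::field^'n^'n \<Rightarrow> 'a \<Rightarrow> bool" where
  "eigenvalue M c \<longleftrightarrow> (\<exists>v. v \<noteq> 0 \<and> M *v v = c *s v)"

definition admissible_sampling :: "real \<Rightarrow> (nat \<Rightarrow> real) \<Rightarrow> bool" where
  "admissible_sampling hbar t \<longleftrightarrow>
     t 0 = 0 \<and> (\<forall>k. t k < t (Suc k)) \<and> filterlim t at_top sequentially \<and>
     (\<forall>k. t (Suc k) - t k \<in> {0<..<hbar})"

definition dint_A :: "real^2^2" where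
  "dint_A = vector [vector [0, 1], vector [0, 0]]"

definition dint_B :: "real^1^2" where
  "dint_B = vector [vector [0], vector [1]]"

text \<open>
  Inputs may jump at the sampling instants. A trajectory is continuous and satisfies the
  differential equation on every \<open>[t\<^sub>k, t\<^sub>k\<^sub>+\<^sub>1)\<close>, with the right derivative at \<open>t\<^sub>k\<close>.
\<close>

definition agent_trajectory ::
  "real^2^2 \<Rightarrow> real^1^2 \<Rightarrow> (nat \<Rightarrow> real) \<Rightarrow> (real \<Rightarrow> real^2) \<Rightarrow> (real \<Rightarrow> real^1) \<Rightarrow> bool" where
  "agent_trajectory A B t x u \<longleftrightarrow>
     continuous_on {0..} x \<and>
     (\<forall>k. \<forall>s\<in>{t k..<t (Suc k)}.
        (x has_vector_derivative (A *v x s + B *v u s)) (at s within {t k..<t (Suc k)}))"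

definition sampled_control_law ::
  "real^2^1 \<Rightarrow> (nat \<Rightarrow> real) \<Rightarrow> (nat \<Rightarrow> real^'n^'n) \<Rightarrow>
   ('n::finite \<Rightarrow> real \<Rightarrow> real^2) \<Rightarrow> ('n \<Rightarrow> real \<Rightarrow> real^1) \<Rightarrow> bool" where
  "sampled_control_law K t W x u \<longleftrightarrow>
     (\<forall>k i. \<forall>s\<in>{t k..<t (Suc k)}.
        u i s = K *v (\<Sum>j\<in>UNIV. W k $ i $ j *\<^sub>R (x j (t k) - x i (t k))))"

text \<open>
  A control law is a relation between the states and the inputs of all agents.
\<close>

definition solves_consensus ::
  "real^2^2 \<Rightarrow> real^1^2 \<Rightarrow> (nat \<Rightarrow> real) \<Rightarrow>
   (('n \<Rightarrow> real \<Rightarrow> real^2) \<Rightarrow> ('n \<Rightarrow> real \<Rightarrow> real^1) \<Rightarrow> bool) \<Rightarrow> bool" where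
  "solves_consensus A B t law \<longleftrightarrow>
     (\<forall>x0 x u. (\<forall>i. x i 0 = x0 i) \<and> (\<forall>i. agent_trajectory A B t (x i) (u i)) \<and> law x u \<longrightarrow>
        (\<forall>i j. ((\<lambda>s. x i s - x j s) \<longlongrightarrow> 0) at_top))"

end

theory Submission
  imports Defs
begin

text \<open>
  Write \<open>p\<close> and \<open>v\<close> for the vectors of all positions and velocities with their averages subtracted.
  Consensus means \<open>p, v \<rightarrow> 0\<close>. The gain has the form \<open>K = [\<kappa> g, \<kappa>]\<close>, so that the input is
  \<open>u = - \<kappa> L w\<close> with \<open>w = g p + v\<close>. In continuous time, \<open>V = |w|\<^sup>2 + |g p|\<^sup>2\<close> would satisfy
  \<open>V' = - 2 \<kappa> w \<bullet> L w + 2 g |w|\<^sup>2 - 2 g |g p|\<^sup>2\<close>: the cross terms cancel, and \<open>w \<bullet> L w \<ge> \<lambda>\<^sub>2 |w|\<^sup>2\<close>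
  makes this negative definite as soon as \<open>g\<close> is small compared with \<open>\<kappa> \<lambda>\<^sub>2\<close>. This \<open>V\<close> depends neither on
  the graph nor on the sampling interval, so it serves for all switching sequences at once.

  Sampling adds terms of second order in the step \<open>h\<close>. Those with \<open>|u|\<^sup>2\<close> are controlled by
  \<open>|L w|\<^sup>2 \<le> \<lambda>\<^sub>N w \<bullet> L w\<close> and the smallness of \<open>\<kappa> \<lambda>\<^sub>N hbar\<close>, the others by that of \<open>g hbar\<close>. The result is
  \<open>V (t\<^sub>k + h) \<le> (1 - g h / 2) V (t\<^sub>k)\<close> for every \<open>h\<close> up to the next sampling instant
  (\<open>lyapunov_step\<close>, \<open>deviation_lyapunov_step\<close>). The loss is proportional to \<open>h\<close>, which matters because the
  intervals may shrink to zero; since \<open>1 - x \<le> exp (- x)\<close>, the losses add up to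
  \<open>V s \<le> exp (- g s / 2) V 0\<close>.

  The two bounds on \<open>L\<close> (\<open>laplacian_lower_bound\<close>, \<open>laplacian_upper_bound\<close>) come from minimising the
  Rayleigh quotient of \<open>L\<close> on the orthogonal complement of the constant vectors, and that of \<open>- L\<close> on
  the whole space: the minimum is attained at an eigenvector. Connectedness of the graph excludes the
  eigenvalue \<open>0\<close> in the first case.
\<close>

section \<open>Extremal eigenvectors of self-adjoint maps\<close>

text \<open>
  The usual discriminant argument, for a form that may be degenerate. The degenerate case is what
  turns a minimiser into an eigenvector below.
\<close>

lemma semidefinite_Cauchy_Schwarz:
  fixes f :: "'a::real_inner \<Rightarrow> 'a"
  assumes "linear f" and sub: "subspace S"
    and sym: "\<And>x y. f x \<bullet> y = x \<bullet> f y"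
    and nonneg: "\<And>x. x \<in> S \<Longrightarrow> 0 \<le> x \<bullet> f x"
    and "x \<in> S" "y \<in> S"
  shows "(x \<bullet> f y)\<^sup>2 \<le> (x \<bullet> f x) * (y \<bullet> f y)"
proof -
  interpret linear f by fact
  have yx: "y \<bullet> f x = x \<bullet> f y"
    using sym[of x y] by (simp add: inner_commute)
  have quad: "0 \<le> a\<^sup>2 * (x \<bullet> f x) + 2 * a * b * (x \<bullet> f y) + b\<^sup>2 * (y \<bullet> f y)" for a b :: real
  proof -
    have "a *\<^sub>R x + b *\<^sub>R y \<in> S"
      using assms by (intro subspace_add subspace_scale) auto
    from nonneg[OF this] show ?thesis
      by (simp add: add scale inner_add_left inner_add_right yx power2_eq_square algebra_simps)
  qed
  show ?thesis
  proof (cases "y \<bullet> f y = 0")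
    case True
    have "x \<bullet> f y = 0"
    proof (rule ccontr)
      \<comment> \<open>Here the quadratic is affine in \<open>b\<close>; this value of \<open>b\<close> makes it equal to \<open>-1\<close>.\<close>
      assume nz: "x \<bullet> f y \<noteq> 0"
      show False
        using quad[of 1 "- (x \<bullet> f x + 1) / (2 * (x \<bullet> f y))"] True nz by (simp add: field_simps)
    qed
    then show ?thesis using True by simp
  next
    case False
    then have pos: "0 < y \<bullet> f y"
      using nonneg[OF \<open>y \<in> S\<close>] by simp
    have "0 \<le> (y \<bullet> f y) * ((x \<bullet> f x) * (y \<bullet> f y) - (x \<bullet> f y)\<^sup>2)"
      using quad[of "y \<bullet> f y" "- (x \<bullet> f y)"] by (simp add: power2_eq_square algebra_simps)
    then show ?thesis
      using pos by (simp add: zero_le_mult_iff)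
  qed
qed

text \<open>
  The Rayleigh quotient attains its minimum \<open>m\<close> at a unit vector \<open>z\<close>. The form of \<open>g = f - m\<close> is
  nonnegative on \<open>S\<close> and vanishes at \<open>z\<close>, so by the Cauchy-Schwarz inequality \<open>g z\<close> is orthogonal to
  itself.
\<close>

lemma self_adjoint_min_eigenvector:
  fixes f :: "'a::euclidean_space \<Rightarrow> 'a"
  assumes "linear f" and sub: "subspace S"
    and sym: "\<And>x y. f x \<bullet> y = x \<bullet> f y"
    and inv: "\<And>x. x \<in> S \<Longrightarrow> f x \<in> S"
    and nontrivial: "S \<noteq> {0}"
  obtains m z where "z \<in> S" "norm z = 1" "f z = m *\<^sub>R z"
    "\<And>y. y \<in> S \<Longrightarrow> m * (y \<bullet> y) \<le> y \<bullet> f y"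
proof -
  interpret linear f by fact
  obtain a where a: "a \<in> S" "a \<noteq> 0"
    using nontrivial subspace_0[OF sub] by blast
  then have "(1 / norm a) *\<^sub>R a \<in> S \<inter> sphere 0 1"
    using sub by (auto simp: subspace_scale)
  moreover have "compact (S \<inter> sphere 0 1)"
    using closed_subspace[OF sub] by (intro closed_Int_compact) auto
  moreover have "continuous_on (S \<inter> sphere 0 1) (\<lambda>y. y \<bullet> f y)"
    by (intro continuous_intros linear_continuous_on linear_conv_bounded_linear[THEN iffD1] \<open>linear f\<close>)
  ultimately obtain z where z: "z \<in> S \<inter> sphere 0 1"
    and zmin: "\<And>y. y \<in> S \<inter> sphere 0 1 \<Longrightarrow> z \<bullet> f z \<le> y \<bullet> f y"
    using continuous_attains_inf[of "S \<inter> sphere 0 1" "\<lambda>y. y \<bullet> f y"] by blast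
  define m where "m = z \<bullet> f z"
  have zS: "z \<in> S" and zn: "norm z = 1" using z by auto
  have bound: "m * (y \<bullet> y) \<le> y \<bullet> f y" if "y \<in> S" for y
  proof (cases "y = 0")
    case False
    have "(1 / norm y) *\<^sub>R y \<in> S \<inter> sphere 0 1"
      using sub that False by (auto simp: subspace_scale)
    from zmin[OF this] show ?thesis
      using False by (simp add: m_def scale field_simps dot_square_norm power2_eq_square)
  qed (simp add: zero)
  define g where "g = (\<lambda>y. f y - m *\<^sub>R y)"
  have "linear g"
    unfolding g_def by (intro linear_compose_sub \<open>linear f\<close> linear_scaleR)
  have rS: "g z \<in> S"
    unfolding g_def using sub zS inv by (intro subspace_diff subspace_scale) auto
  have "(g z \<bullet> g z)\<^sup>2 \<le> (g z \<bullet> g (g z)) * (z \<bullet> g z)"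
  proof (rule semidefinite_Cauchy_Schwarz[OF \<open>linear g\<close> sub])
    show "g x \<bullet> y = x \<bullet> g y" for x y
      by (simp add: g_def inner_diff_left inner_diff_right sym)
    show "0 \<le> x \<bullet> g x" if "x \<in> S" for x
      using bound[OF that] by (simp add: g_def inner_diff_right)
  qed (use rS zS in auto)
  also have "z \<bullet> g z = 0"
    using zn by (simp add: g_def inner_diff_right m_def dot_square_norm)
  finally have "g z = 0" by simp
  then show thesis
    using that[OF zS zn _ bound] by (simp add: g_def)
qed

section \<open>Spectral bounds for weighted Laplacians\<close>

lemma laplacian_mult_nth:
  fixes W :: "real^'n::finite^'n"
  shows "(laplacian W *v y) $ i = (\<Sum>j\<in>UNIV. W $ i $ j * (y $ i - y $ j))"
proof -
  have "(laplacian W *v y) $ i =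
      (\<Sum>j\<in>UNIV. (if i = j then in_degree W i * y $ j else 0)) - (\<Sum>j\<in>UNIV. W $ i $ j * y $ j)"
    unfolding sum_subtractf[symmetric]
    by (auto simp: laplacian_def matrix_vector_mult_def left_diff_distrib intro!: sum.cong)
  also have "\<dots> = in_degree W i * y $ i - (\<Sum>j\<in>UNIV. W $ i $ j * y $ j)"
    by simp
  also have "\<dots> = (\<Sum>j\<in>UNIV. W $ i $ j * (y $ i - y $ j))"
    by (simp add: in_degree_def sum_distrib_right right_diff_distrib sum_subtractf)
  finally show ?thesis .
qed

lemma balanced_nth: "balanced W \<Longrightarrow> W $ i $ j = W $ j $ i"
  unfolding balanced_def by (metis transpose_def vec_lambda_beta)

lemma inner_laplacian:
  fixes W :: "real^'n::finite^'n"
  assumes "balanced W"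
  shows "2 * (x \<bullet> (laplacian W *v y)) =
    (\<Sum>i\<in>UNIV. \<Sum>j\<in>UNIV. W $ i $ j * ((x $ i - x $ j) * (y $ i - y $ j)))"
proof -
  have "x \<bullet> (laplacian W *v y) = (\<Sum>i\<in>UNIV. \<Sum>j\<in>UNIV. W $ i $ j * (x $ i * (y $ i - y $ j)))"
    by (simp add: inner_vec_def laplacian_mult_nth sum_distrib_left mult_ac)
  moreover have "\<dots> = (\<Sum>i\<in>UNIV. \<Sum>j\<in>UNIV. W $ i $ j * (x $ j * (y $ j - y $ i)))"
    by (subst sum.swap) (simp add: balanced_nth[OF assms] cong: sum.cong)
  ultimately have "2 * (x \<bullet> (laplacian W *v y)) =
      (\<Sum>i\<in>UNIV. \<Sum>j\<in>UNIV. W $ i $ j * (x $ i * (y $ i - y $ j))) +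
      (\<Sum>i\<in>UNIV. \<Sum>j\<in>UNIV. W $ i $ j * (x $ j * (y $ j - y $ i)))"
    by simp
  also have "\<dots> = (\<Sum>i\<in>UNIV. \<Sum>j\<in>UNIV. W $ i $ j * ((x $ i - x $ j) * (y $ i - y $ j)))"
    unfolding sum.distrib[symmetric] by (simp add: algebra_simps)
  finally show ?thesis .
qed

lemma laplacian_self_adjoint:
  fixes W :: "real^'n::finite^'n"
  assumes "balanced W"
  shows "(laplacian W *v x) \<bullet> y = x \<bullet> (laplacian W *v y)"
  using inner_laplacian[OF assms, of x y] inner_laplacian[OF assms, of y x]
  by (simp add: inner_commute mult.commute mult.left_commute)

lemma weighted_adjacency_nonneg: "weighted_adjacency E W \<Longrightarrow> 0 \<le> W $ i $ j"
  unfolding weighted_adjacency_def by (metis order.refl less_imp_le)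

lemma laplacian_nonneg:
  fixes W :: "real^'n::finite^'n"
  assumes "weighted_adjacency E W" "balanced W"
  shows "0 \<le> x \<bullet> (laplacian W *v x)"
proof -
  have "0 \<le> (\<Sum>i\<in>UNIV. \<Sum>j\<in>UNIV. W $ i $ j * ((x $ i - x $ j) * (x $ i - x $ j)))"
    by (intro sum_nonneg mult_nonneg_nonneg[OF weighted_adjacency_nonneg[OF assms(1)]]) simp
  then show ?thesis
    using inner_laplacian[OF assms(2), of x x] by linarith
qed

text \<open>
  The Dirichlet form is a sum of nonnegative terms, one for each edge; if it vanishes, the values
  agree along edges, hence along the paths to the root of the spanning tree.
\<close>

lemma laplacian_form_zero_imp_const:
  fixes W :: "real^'n::finite^'n"
  assumes W: "weighted_adjacency E W" "balanced W" and "has_spanning_tree E"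
    and zero: "x \<bullet> (laplacian W *v x) = 0"
  shows "x $ i = x $ j"
proof -
  have nn: "0 \<le> W $ i $ j * ((x $ i - x $ j) * (x $ i - x $ j))" for i j
    using weighted_adjacency_nonneg[OF W(1)] by simp
  have "(\<Sum>i\<in>UNIV. \<Sum>j\<in>UNIV. W $ i $ j * ((x $ i - x $ j) * (x $ i - x $ j))) = 0"
    using inner_laplacian[OF W(2), of x x] zero by simp
  then have prod0: "W $ i $ j * ((x $ i - x $ j) * (x $ i - x $ j)) = 0" for i j
    by (simp add: sum_nonneg_eq_0_iff nn sum_nonneg)
  have edge: "x $ i = x $ j" if "(i, j) \<in> E" for i j
    using prod0[of i j] W(1) that unfolding weighted_adjacency_def by force
  obtain T r where T: "T \<subseteq> E" "\<And>i. (i, r) \<in> T\<^sup>*"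
    using assms(3) unfolding has_spanning_tree_def directed_tree_def by blast
  have "x $ i = x $ r" for i
    using T(2)[of i] by (induction rule: converse_rtrancl_induct) (use edge T(1) in auto)
  then show ?thesis by metis
qed

definition center :: "real^'n \<Rightarrow> real^'n::finite" where
  "center y = y - ((y \<bullet> 1) / real CARD('n)) *\<^sub>R 1"

lemma inner_one_one: "(1::real^'n::finite) \<bullet> 1 = real CARD('n)"
  by (simp add: inner_vec_def)

lemma center_orthogonal: "center y \<bullet> 1 = 0"
  by (simp add: center_def inner_diff_left inner_one_one)

lemma center_add: "center (x + y) = center x + center y"
  by (simp add: center_def inner_add_left add_divide_distrib scaleR_add_left)

lemma center_scaleR: "center (c *\<^sub>R y) = c *\<^sub>R center y"
  by (simp add: center_def scaleR_diff_right)

lemma center_nth_diff: "center y $ i - center y $ j = y $ i - y $ j"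
  by (simp add: center_def)

lemma laplacian_orthogonal:
  fixes W :: "real^'n::finite^'n"
  assumes "balanced W"
  shows "(laplacian W *v y) \<bullet> 1 = 0"
  using inner_laplacian[OF assms, of 1 y] by (simp add: inner_commute)

lemma center_laplacian:
  fixes W :: "real^'n::finite^'n"
  shows "balanced W \<Longrightarrow> center (laplacian W *v y) = laplacian W *v y"
  by (simp add: center_def laplacian_orthogonal)

lemma laplacian_center:
  fixes W :: "real^'n::finite^'n"
  shows "laplacian W *v center y = laplacian W *v y"
  by (simp add: vec_eq_iff laplacian_mult_nth center_nth_diff)

lemma laplacian_lower_bound:
  fixes W :: "real^'n::finite^'n"
  assumes W: "weighted_adjacency E W" "balanced W" and tree: "has_spanning_tree E"
    and ev: "\<And>\<mu>. eigenvalue (laplacian W) \<mu> \<Longrightarrow> \<mu> \<noteq> 0 \<Longrightarrow> a \<le> \<mu>"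
    and y: "y \<bullet> 1 = 0"
  shows "a * (y \<bullet> y) \<le> y \<bullet> (laplacian W *v y)"
proof (cases "{x::real^'n. x \<bullet> 1 = 0} = {0}")
  case True
  then have "y = 0" using y by blast
  then show ?thesis by simp
next
  case False
  have sub: "subspace {x::real^'n. x \<bullet> 1 = 0}"
    by (auto simp: subspace_def inner_add_left)
  have inv: "laplacian W *v y \<in> {x. x \<bullet> 1 = 0}" for y
    by (simp add: laplacian_orthogonal[OF W(2)])
  obtain m z where z: "z \<in> {x. x \<bullet> 1 = 0}" "norm z = 1" "laplacian W *v z = m *\<^sub>R z"
    and min: "\<And>y. y \<in> {x. x \<bullet> 1 = 0} \<Longrightarrow> m * (y \<bullet> y) \<le> y \<bullet> (laplacian W *v y)"
    using self_adjoint_min_eigenvector[OF matrix_vector_mul_linear sub laplacian_self_adjoint[OF W(2)] inv False]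
    by blast
  have "z \<noteq> 0" using z(2) by auto
  have "m \<noteq> 0"
  proof
    assume "m = 0"
    then have "\<And>i j. z $ i = z $ j"
      using laplacian_form_zero_imp_const[OF W tree, of z] z(3) by simp
    then have "\<exists>c. z = c *\<^sub>R 1"
      by (intro exI[of _ "z $ undefined"]) (simp add: vec_eq_iff)
    then obtain c where c: "z = c *\<^sub>R 1" ..
    then show False
      using z(1) \<open>z \<noteq> 0\<close> by (simp add: inner_one_one)
  qed
  moreover have "eigenvalue (laplacian W) m"
    unfolding eigenvalue_def using z(3) \<open>z \<noteq> 0\<close> by (auto simp: scalar_mult_eq_scaleR)
  ultimately have "a \<le> m" using ev by blast
  then have "a * (y \<bullet> y) \<le> m * (y \<bullet> y)" by (simp add: mult_right_mono)
  also have "\<dots> \<le> y \<bullet> (laplacian W *v y)" using min y by simp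
  finally show ?thesis .
qed

text \<open>
  The largest eigenvalue bounds the form of \<open>L\<close> by \<open>b\<close>; the bound on the norm of \<open>L y\<close> then follows from
  the Cauchy-Schwarz inequality for that form, applied to \<open>L y\<close> and \<open>y\<close>. It is stronger than
  \<open>|L y| \<le> b |y|\<close> in the way that is needed later: the squared input is dominated by the dissipation
  itself.
\<close>

lemma laplacian_upper_bound:
  fixes W :: "real^'n::finite^'n"
  assumes W: "weighted_adjacency E W" "balanced W" and "0 \<le> b"
    and ev: "\<And>\<mu>. eigenvalue (laplacian W) \<mu> \<Longrightarrow> \<mu> \<noteq> 0 \<Longrightarrow> \<mu> \<le> b"
  shows "(norm (laplacian W *v y))\<^sup>2 \<le> b * (y \<bullet> (laplacian W *v y))"
proof -
  let ?L = "\<lambda>y. laplacian W *v y"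
  have nontriv: "(UNIV :: (real^'n) set) \<noteq> {0}"
    by (metis UNIV_I singletonD zero_neq_one)
  have lin: "linear (\<lambda>y. - ?L y)"
    by (intro linear_compose_neg matrix_vector_mul_linear)
  have sym: "(- ?L x) \<bullet> y = x \<bullet> (- ?L y)" for x y
    by (simp add: laplacian_self_adjoint[OF W(2)])
  obtain m z where z: "norm z = 1" "- ?L z = m *\<^sub>R z"
    and min: "\<And>y. m * (y \<bullet> y) \<le> y \<bullet> (- ?L y)"
    by (rule self_adjoint_min_eigenvector[OF lin subspace_UNIV sym UNIV_I nontriv]) (rule that; simp)
  have "?L z = (-m) *\<^sub>R z" using z(2) by (metis minus_minus scaleR_minus_left)
  then have "eigenvalue (laplacian W) (-m)"
    unfolding eigenvalue_def using z(1) by (intro exI[of _ z]) (auto simp: scalar_mult_eq_scaleR)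
  then have "-m \<le> b" using ev \<open>0 \<le> b\<close> by (cases "m = 0") auto
  have upper: "x \<bullet> ?L x \<le> b * (x \<bullet> x)" for x
  proof -
    have "x \<bullet> ?L x \<le> (-m) * (x \<bullet> x)" using min[of x] by simp
    also have "\<dots> \<le> b * (x \<bullet> x)" using \<open>-m \<le> b\<close> by (intro mult_right_mono) auto
    finally show ?thesis .
  qed
  have "(?L y \<bullet> ?L y)\<^sup>2 \<le> (?L y \<bullet> ?L (?L y)) * (y \<bullet> ?L y)"
    by (rule semidefinite_Cauchy_Schwarz[of ?L UNIV])
       (auto simp: laplacian_self_adjoint[OF W(2)] laplacian_nonneg[OF W])
  also have "\<dots> \<le> (b * (?L y \<bullet> ?L y)) * (y \<bullet> ?L y)"
    using upper laplacian_nonneg[OF W] by (intro mult_right_mono) auto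
  finally have "(?L y \<bullet> ?L y) * (?L y \<bullet> ?L y) \<le> (b * (y \<bullet> ?L y)) * (?L y \<bullet> ?L y)"
    by (simp add: power2_eq_square mult_ac)
  then have "?L y \<bullet> ?L y \<le> b * (y \<bullet> ?L y) \<or> ?L y = 0"
    by (metis inner_gt_zero_iff mult_right_le_imp_le)
  then show ?thesis
    by (auto simp: power2_norm_eq_inner)
qed

section \<open>The Lyapunov function\<close>

definition lyapunov :: "real \<Rightarrow> 'a::real_inner \<Rightarrow> 'a \<Rightarrow> real" where
  "lyapunov g p v = (norm (g *\<^sub>R p + v))\<^sup>2 + (norm (g *\<^sub>R p))\<^sup>2"

text \<open>
  One step of length \<open>h\<close> under a constant input \<open>u\<close>. The quantity \<open>- (w \<bullet> u)\<close> with \<open>w = g p + v\<close> is the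
  dissipation of the feedback; \<open>damp\<close> says that it outweighs the growth \<open>2 g |w|\<^sup>2\<close> caused by the
  drift, and \<open>small\<close> that the second-order effect of the input does not use it up.
\<close>

lemma lyapunov_step:
  fixes p v u :: "'a::real_inner"
  assumes "0 < g" "0 \<le> h" and gh: "40 * g * h \<le> 1"
    and damp: "4 * g * (norm (g *\<^sub>R p + v))\<^sup>2 \<le> - ((g *\<^sub>R p + v) \<bullet> u)"
    and small: "10 * h * (norm u)\<^sup>2 \<le> - ((g *\<^sub>R p + v) \<bullet> u)"
  shows "lyapunov g (p + h *\<^sub>R v + (h\<^sup>2 / 2) *\<^sub>R u) (v + h *\<^sub>R u) \<le> (1 - g * h / 2) * lyapunov g p v"
proof -
  define w P d where "w = g *\<^sub>R p + v" and "P = g *\<^sub>R p" and "d = w - P"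
  define \<tau> where "\<tau> = - (w \<bullet> u)"
  define q where "q = g * h"
  have q: "0 \<le> q" "q \<le> 1/40" using assms by (auto simp: q_def)
  have v: "v = w - P" by (simp add: w_def P_def)
  have P': "g *\<^sub>R (p + h *\<^sub>R v + (h\<^sup>2 / 2) *\<^sub>R u) = P + q *\<^sub>R (w - P) + (q * h / 2) *\<^sub>R u"
  proof -
    have "g *\<^sub>R (p + h *\<^sub>R v + (h\<^sup>2 / 2) *\<^sub>R u) = P + (g * h) *\<^sub>R v + (g * (h\<^sup>2 / 2)) *\<^sub>R u"
      by (simp add: P_def scaleR_add_right)
    also have "g * (h\<^sup>2 / 2) = q * h / 2" by (simp add: q_def power2_eq_square)
    finally show ?thesis by (simp only: v q_def)
  qed
  have w': "g *\<^sub>R (p + h *\<^sub>R v + (h\<^sup>2 / 2) *\<^sub>R u) + (v + h *\<^sub>R u) =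
      w + q *\<^sub>R (w - P) + (h + q * h / 2) *\<^sub>R u"
    unfolding P' by (simp add: v algebra_simps)
  define e1 where "e1 = q * h * ((w + P) \<bullet> u)"
  define e2 where "e2 = 2 * q * h * (1 + q) * (d \<bullet> u)"
  define e3 where "e3 = (1 + q + q\<^sup>2 / 2) * (h\<^sup>2 * (u \<bullet> u))"
  have eq: "lyapunov g (p + h *\<^sub>R v + (h\<^sup>2 / 2) *\<^sub>R u) (v + h *\<^sub>R u) =
      w \<bullet> w + P \<bullet> P + 2 * (q * (w \<bullet> w) - q * (P \<bullet> P)) - 2 * (h * \<tau>)
      + e1 + 2 * (q\<^sup>2 * (d \<bullet> d)) + e2 + e3"
  proof -
    have sq3: "(x + a *\<^sub>R y + b *\<^sub>R z) \<bullet> (x + a *\<^sub>R y + b *\<^sub>R z) =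
        x \<bullet> x + a\<^sup>2 * (y \<bullet> y) + b\<^sup>2 * (z \<bullet> z) + 2 * a * (x \<bullet> y) + 2 * b * (x \<bullet> z) + 2 * a * b * (y \<bullet> z)"
      for x y z :: 'a and a b
      by (simp add: inner_add_left inner_add_right inner_commute[of y x] inner_commute[of z x]
          inner_commute[of z y] power2_eq_square algebra_simps)
    have wd: "w \<bullet> d = w \<bullet> w - w \<bullet> P" and Pd: "P \<bullet> d = w \<bullet> P - P \<bullet> P"
      by (simp_all add: d_def inner_diff_right inner_commute[of P w])
    show ?thesis
      unfolding lyapunov_def w' unfolding P' power2_norm_eq_inner d_def[symmetric] sq3 wd Pd
        \<tau>_def e1_def e2_def e3_def inner_add_left[of w P]
      by (simp add: power2_eq_square field_simps)
  qed
  \<comment> \<open>Every error term is now bounded by a multiple of \<open>q\<^sup>2 S\<close> or of \<open>h\<^sup>2 |u|\<^sup>2\<close>.\<close>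
  define S where "S = w \<bullet> w + P \<bullet> P"
  have damp': "4 * g * (w \<bullet> w) \<le> \<tau>" and small': "10 * h * (u \<bullet> u) \<le> \<tau>"
    using damp small by (simp_all add: w_def \<tau>_def power2_norm_eq_inner)
  have Snn: "0 \<le> S" by (simp add: S_def)
  have sq: "0 \<le> (q *\<^sub>R x - h *\<^sub>R u) \<bullet> (q *\<^sub>R x - h *\<^sub>R u)" for x by simp
  have cross: "2 * q * h * (x \<bullet> u) \<le> q\<^sup>2 * (x \<bullet> x) + h\<^sup>2 * (u \<bullet> u)" for x
    using sq[of x] by (simp add: inner_diff_left inner_diff_right inner_commute[of u x]
        power2_eq_square algebra_simps)
  have para: "(w + P) \<bullet> (w + P) + d \<bullet> d = 2 * S"
    by (simp add: d_def S_def inner_add_left inner_add_right inner_diff_left inner_diff_right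
        inner_commute[of P w])
  have d2: "d \<bullet> d \<le> 2 * S" and s2: "(w + P) \<bullet> (w + P) \<le> 2 * S"
    using para inner_ge_zero[of d] inner_ge_zero[of "w + P"] by linarith+
  have qd: "q\<^sup>2 * (d \<bullet> d) \<le> 2 * (q\<^sup>2 * S)" and qe: "q\<^sup>2 * ((w + P) \<bullet> (w + P)) \<le> 2 * (q\<^sup>2 * S)"
    using mult_left_mono[OF d2, of "q\<^sup>2"] mult_left_mono[OF s2, of "q\<^sup>2"] by simp_all
  have qq: "q\<^sup>2 * S \<le> (1/40) * (q * S)"
    using mult_right_mono[OF mult_left_mono[OF q(2) q(1)] Snn] by (simp add: power2_eq_square)
  have uu: "h\<^sup>2 * (u \<bullet> u) \<le> h * \<tau> / 10"
    using mult_left_mono[OF small' \<open>0 \<le> h\<close>] by (simp add: power2_eq_square)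
  have ww: "4 * (q * (w \<bullet> w)) \<le> h * \<tau>"
    using mult_left_mono[OF damp' \<open>0 \<le> h\<close>] by (simp add: q_def mult_ac)
  have huu: "0 \<le> h\<^sup>2 * (u \<bullet> u)" "0 \<le> q\<^sup>2 * (d \<bullet> d)" by simp_all
  have t1: "e1 \<le> q\<^sup>2 * S + h\<^sup>2 * (u \<bullet> u) / 2"
    using cross[of "w + P"] qe unfolding e1_def by linarith
  have t2: "e2 \<le> 2 * (2 * (q\<^sup>2 * S) + h\<^sup>2 * (u \<bullet> u))"
  proof -
    have "e2 = (1 + q) * (2 * q * h * (d \<bullet> u))" by (simp add: e2_def)
    also have "\<dots> \<le> (1 + q) * (q\<^sup>2 * (d \<bullet> d) + h\<^sup>2 * (u \<bullet> u))"
      using cross[of d] q by (intro mult_left_mono) auto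
    also have "\<dots> \<le> 2 * (q\<^sup>2 * (d \<bullet> d) + h\<^sup>2 * (u \<bullet> u))"
      using q huu by (intro mult_right_mono) auto
    also have "\<dots> \<le> 2 * (2 * (q\<^sup>2 * S) + h\<^sup>2 * (u \<bullet> u))"
      using qd by (simp add: mult.commute)
    finally show ?thesis .
  qed
  have t3: "e3 \<le> 2 * (h\<^sup>2 * (u \<bullet> u))"
    unfolding e3_def
  proof (rule mult_right_mono)
    have "q\<^sup>2 \<le> 1" using q by (simp add: power_le_one)
    then show "1 + q + q\<^sup>2 / 2 \<le> 2" using q by linarith
  qed (use huu in auto)
  have qS: "q * S = q * (w \<bullet> w) + q * (P \<bullet> P)" by (simp add: S_def distrib_left)
  have nnP: "0 \<le> q * (P \<bullet> P)" "0 \<le> q * (w \<bullet> w)" using q by simp_all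
  have "lyapunov g (p + h *\<^sub>R v + (h\<^sup>2 / 2) *\<^sub>R u) (v + h *\<^sub>R u) \<le> S - q * S / 2"
  proof -
    have "x + 2 * (a - b) - 2 * T + e1 + 2 * D + e2 + e3 \<le> x - R / 2"
      if "e1 \<le> Z + Y / 2" "e2 \<le> 2 * (2 * Z + Y)" "e3 \<le> 2 * Y" "D \<le> 2 * Z" "Z \<le> 1 / 40 * R"
        "Y \<le> T / 10" "4 * a \<le> T" "R = a + b" "0 \<le> b" "0 \<le> a"
      for x a b T D Z Y R :: real
      using that by argo
    from this[OF t1 t2 t3 qd qq uu ww qS nnP] show ?thesis
      unfolding eq S_def .
  qed
  also have "\<dots> = (1 - g * h / 2) * lyapunov g p v"
  proof -
    have "lyapunov g p v = S"
      unfolding lyapunov_def S_def w_def P_def power2_norm_eq_inner ..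
    then show ?thesis by (simp add: q_def algebra_simps)
  qed
  finally show ?thesis .
qed

lemma lyapunov_tendsto_zero:
  fixes p v :: "'b \<Rightarrow> 'a::real_inner"
  assumes "0 < g" and lim: "((\<lambda>s. lyapunov g (p s) (v s)) \<longlongrightarrow> 0) F"
  shows "(p \<longlongrightarrow> 0) F" "(v \<longlongrightarrow> 0) F"
proof -
  have sqrt0: "((\<lambda>s. sqrt (lyapunov g (p s) (v s))) \<longlongrightarrow> 0) F"
    using tendsto_real_sqrt[OF lim] by simp
  have w: "((\<lambda>s. g *\<^sub>R p s + v s) \<longlongrightarrow> 0) F"
    by (rule Lim_null_comparison[OF _ sqrt0])
       (auto intro!: always_eventually real_le_rsqrt simp: lyapunov_def)
  have gp: "((\<lambda>s. g *\<^sub>R p s) \<longlongrightarrow> 0) F"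
    by (rule Lim_null_comparison[OF _ sqrt0])
       (auto intro!: always_eventually real_le_rsqrt simp: lyapunov_def simp del: norm_scaleR)
  show "(v \<longlongrightarrow> 0) F" using tendsto_diff[OF w gp] by simp
  show "(p \<longlongrightarrow> 0) F"
    using tendsto_scaleR[OF tendsto_const gp, of "1 / g"] \<open>0 < g\<close> by simp
qed

section \<open>Trajectories between sampling instants\<close>

text \<open>
  The differential equation is used on the open interval only; continuity extends the formula to
  the right end point, where the input may jump.
\<close>

lemma double_integrator_constant_input:
  fixes p v :: "real \<Rightarrow> real"
  assumes cont: "continuous_on {a..b} p" "continuous_on {a..b} v"
    and dp: "\<And>s. s \<in> {a<..<b} \<Longrightarrow> (p has_real_derivative v s) (at s)"
    and dv: "\<And>s. s \<in> {a<..<b} \<Longrightarrow> (v has_real_derivative c) (at s)"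
    and s: "s \<in> {a..b}"
  shows "v s = v a + (s - a) * c" "p s = p a + (s - a) * v a + (s - a)\<^sup>2 / 2 * c"
proof -
  have vs: "v s = v a + (s - a) * c" if s: "s \<in> {a..b}" for s
  proof (cases "a < b")
    case True
    have "continuous_on {a..b} (\<lambda>s. v s - (s - a) * c)"
      by (intro continuous_intros cont)
    moreover have "((\<lambda>s. v s - (s - a) * c) has_real_derivative 0) (at s)" if "s \<in> {a<..<b}" for s
      by (rule derivative_eq_intros dv that refl | simp)+
    ultimately have "v s - (s - a) * c = v a - (a - a) * c"
      using DERIV_isconst2[OF True, of "\<lambda>s. v s - (s - a) * c" s] s by simp
    then show ?thesis by simp
  next
    case False
    then have "s = a" using s by auto
    then show ?thesis by simp
  qed
  show "v s = v a + (s - a) * c" using vs[OF s] .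
  show "p s = p a + (s - a) * v a + (s - a)\<^sup>2 / 2 * c"
  proof (cases "a < b")
    case True
    let ?f = "\<lambda>s. p s - (s - a) * v a - (s - a)\<^sup>2 / 2 * c"
    have "continuous_on {a..b} ?f"
      by (intro continuous_intros cont) auto
    moreover have "(?f has_real_derivative 0) (at s)" if "s \<in> {a<..<b}" for s
    proof -
      have "(?f has_real_derivative v s - v a - (s - a) * c) (at s)"
        by (auto intro!: derivative_eq_intros dp[OF that])
      then show ?thesis using that vs[of s] by simp
    qed
    ultimately have "?f s = ?f a"
      using DERIV_isconst2[OF True, of ?f s] s by simp
    then show ?thesis by simp
  next
    case False
    then have "s = a" using s by auto
    then show ?thesis by simp
  qed
qed

lemma dint_field_nth:
  "(dint_A *v x + dint_B *v u) $ 1 = x $ 2" "(dint_A *v x + dint_B *v u) $ 2 = u $ 1"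
  by (simp_all add: dint_A_def dint_B_def matrix_vector_mult_def sum_2 vector_2 vector_def)

lemma agent_trajectory_sampled:
  assumes traj: "agent_trajectory dint_A dint_B t x u" and "0 \<le> t k"
    and const: "\<And>s. s \<in> {t k..<t (Suc k)} \<Longrightarrow> u s $ 1 = c"
    and s: "s \<in> {t k..t (Suc k)}"
  shows "x s $ 2 = x (t k) $ 2 + (s - t k) * c"
    "x s $ 1 = x (t k) $ 1 + (s - t k) * x (t k) $ 2 + (s - t k)\<^sup>2 / 2 * c"
proof -
  have cont: "continuous_on {t k..t (Suc k)} (\<lambda>s. x s $ i)" for i
    using traj \<open>0 \<le> t k\<close> unfolding agent_trajectory_def
    by (intro continuous_on_component) (auto intro: continuous_on_subset)
  have deriv: "((\<lambda>s. x s $ i) has_real_derivative (dint_A *v x s + dint_B *v u s) $ i) (at s)"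
    if s: "s \<in> {t k<..<t (Suc k)}" for s i
  proof -
    have "(x has_vector_derivative (dint_A *v x s + dint_B *v u s)) (at s within {t k..<t (Suc k)})"
      using traj s unfolding agent_trajectory_def by auto
    then have "(x has_vector_derivative (dint_A *v x s + dint_B *v u s)) (at s within {t k<..<t (Suc k)})"
      by (rule has_vector_derivative_within_subset) auto
    moreover have "at s within {t k<..<t (Suc k)} = at s"
      using s by (intro at_within_open) auto
    ultimately have "(x has_vector_derivative (dint_A *v x s + dint_B *v u s)) (at s)"
      by simp
    from bounded_linear.has_vector_derivative[OF bounded_linear_vec_nth this]
    show ?thesis by (simp add: has_real_derivative_iff_has_vector_derivative)
  qed
  have d1: "((\<lambda>s. x s $ 1) has_real_derivative x s $ 2) (at s)"
    and d2: "((\<lambda>s. x s $ 2) has_real_derivative c) (at s)" if "s \<in> {t k<..<t (Suc k)}" for s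
    using deriv[OF that, of 1, unfolded dint_field_nth] deriv[OF that, of 2, unfolded dint_field_nth]
      const[of s] that by auto
  show "x s $ 2 = x (t k) $ 2 + (s - t k) * c"
    "x s $ 1 = x (t k) $ 1 + (s - t k) * x (t k) $ 2 + (s - t k)\<^sup>2 / 2 * c"
    using double_integrator_constant_input[OF cont cont d1 d2 s] by auto
qed

definition gain :: "real \<Rightarrow> real \<Rightarrow> real^2^1" where
  "gain \<kappa> g = vector [vector [\<kappa> * g, \<kappa>]]"

lemma gain_mult_nth: "(gain \<kappa> g *v y) $ 1 = \<kappa> * (g * y $ 1 + y $ 2)"
  by (simp add: gain_def matrix_vector_mult_def sum_2 vector_def algebra_simps)

lemma sampled_input:
  assumes "sampled_control_law (gain \<kappa> g) t W x u" "s \<in> {t k..<t (Suc k)}"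
  shows "u i s $ 1 = - \<kappa> * (laplacian (W k) *v (\<chi> j. g * x j (t k) $ 1 + x j (t k) $ 2)) $ i"
proof -
  have "u i s = gain \<kappa> g *v (\<Sum>j\<in>UNIV. W k $ i $ j *\<^sub>R (x j (t k) - x i (t k)))"
    using assms unfolding sampled_control_law_def by blast
  then show ?thesis
    by (simp add: gain_mult_nth laplacian_mult_nth sum_distrib_left sum_negf[symmetric]
        sum.distrib[symmetric] algebra_simps)
qed

section \<open>Consensus\<close>

definition deviation :: "('n::finite \<Rightarrow> real \<Rightarrow> real^2) \<Rightarrow> 2 \<Rightarrow> real \<Rightarrow> real^'n" where
  "deviation x c s = center (\<chi> i. x i s $ c)"

text \<open>
  Centering commutes with the closed loop because the Laplacian of a balanced graph annihilates the
  constant vectors and its image is orthogonal to them. The average itself moves freely.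
\<close>

lemma deviation_sampled:
  assumes traj: "\<And>i. agent_trajectory dint_A dint_B t (x i) (u i)"
    and law: "sampled_control_law (gain \<kappa> g) t W x u"
    and "balanced (W k)" "0 \<le> t k" and s: "s \<in> {t k..t (Suc k)}"
  defines "U \<equiv> (- \<kappa>) *\<^sub>R (laplacian (W k) *v (g *\<^sub>R deviation x 1 (t k) + deviation x 2 (t k)))"
  shows "deviation x 2 s = deviation x 2 (t k) + (s - t k) *\<^sub>R U"
    "deviation x 1 s = deviation x 1 (t k) + (s - t k) *\<^sub>R deviation x 2 (t k) + ((s - t k)\<^sup>2 / 2) *\<^sub>R U"
proof -
  let ?y = "\<chi> j. g * x j (t k) $ 1 + x j (t k) $ 2"
  have "g *\<^sub>R deviation x 1 (t k) + deviation x 2 (t k) = center ?y"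
    unfolding deviation_def center_scaleR[symmetric] center_add[symmetric]
    by (rule arg_cong[of _ _ center]) (simp add: vec_eq_iff)
  then have U: "U = (- \<kappa>) *\<^sub>R (laplacian (W k) *v ?y)"
    by (simp add: U_def laplacian_center)
  have cU: "center U = U"
    unfolding U center_scaleR center_laplacian[OF assms(3)] ..
  have nth: "x i s $ 2 = x i (t k) $ 2 + (s - t k) * U $ i"
    "x i s $ 1 = x i (t k) $ 1 + (s - t k) * x i (t k) $ 2 + (s - t k)\<^sup>2 / 2 * U $ i" for i
    using agent_trajectory_sampled[OF traj[of i] \<open>0 \<le> t k\<close> sampled_input[OF law, where i = i] s]
    by (simp_all add: U)
  have "(\<chi> i. x i s $ 2) = (\<chi> i. x i (t k) $ 2) + (s - t k) *\<^sub>R U"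
    by (simp add: vec_eq_iff nth(1))
  then show "deviation x 2 s = deviation x 2 (t k) + (s - t k) *\<^sub>R U"
    unfolding deviation_def by (simp only: center_add center_scaleR cU)
  have "(\<chi> i. x i s $ 1) = (\<chi> i. x i (t k) $ 1) + (s - t k) *\<^sub>R (\<chi> i. x i (t k) $ 2) + ((s - t k)\<^sup>2 / 2) *\<^sub>R U"
    by (simp add: vec_eq_iff nth(2))
  then show "deviation x 1 s = deviation x 1 (t k) + (s - t k) *\<^sub>R deviation x 2 (t k) + ((s - t k)\<^sup>2 / 2) *\<^sub>R U"
    unfolding deviation_def by (simp only: center_add center_scaleR cU)
qed

text \<open>
  The choice of \<open>\<kappa>\<close> means \<open>10 \<kappa> lamN hbar = 1\<close>, which is the input bound needed in \<open>lyapunov_step\<close>.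
  Then \<open>4 g = \<kappa> lam2\<close> gives the damping condition, and \<open>40 g hbar = lam2 / lamN \<le> 1\<close> holds
  automatically.
\<close>

lemma deviation_lyapunov_step:
  assumes "0 < hbar" "0 < lam2" "lam2 \<le> lamN"
    and \<kappa>_def: "\<kappa> = 1 / (10 * lamN * hbar)" and g_def: "g = lam2 / (40 * lamN * hbar)"
    and traj: "\<And>i. agent_trajectory dint_A dint_B t (x i) (u i)"
    and law: "sampled_control_law (gain \<kappa> g) t W x u"
    and W: "weighted_adjacency E (W k)" "balanced (W k)" and tree: "has_spanning_tree E"
    and ev: "\<And>\<mu>. eigenvalue (laplacian (W k)) \<mu> \<Longrightarrow> \<mu> \<noteq> 0 \<Longrightarrow> \<mu> \<in> {lam2..lamN}"
    and "0 \<le> t k" "t (Suc k) - t k < hbar" and s: "s \<in> {t k..t (Suc k)}"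
  shows "lyapunov g (deviation x 1 s) (deviation x 2 s) \<le>
    (1 - g * (s - t k) / 2) * lyapunov g (deviation x 1 (t k)) (deviation x 2 (t k))"
proof -
  define h where "h = s - t k"
  have h: "0 \<le> h" "h \<le> hbar" using s assms by (auto simp: h_def)
  have pos: "0 < lamN" "0 < \<kappa>" "0 < g" using assms by (auto simp: \<kappa>_def g_def)
  define w where "w = g *\<^sub>R deviation x 1 (t k) + deviation x 2 (t k)"
  define U where "U = (- \<kappa>) *\<^sub>R (laplacian (W k) *v w)"
  have "w \<bullet> 1 = 0"
    by (simp add: w_def inner_add_left deviation_def center_orthogonal)
  then have lower: "lam2 * (w \<bullet> w) \<le> w \<bullet> (laplacian (W k) *v w)"
    using ev by (intro laplacian_lower_bound[OF W tree]) auto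
  have upper: "(norm (laplacian (W k) *v w))\<^sup>2 \<le> lamN * (w \<bullet> (laplacian (W k) *v w))"
    using ev pos by (intro laplacian_upper_bound[OF W]) auto
  have wU: "- (w \<bullet> U) = \<kappa> * (w \<bullet> (laplacian (W k) *v w))"
    by (simp add: U_def)
  have "4 * g = \<kappa> * lam2" by (simp add: g_def \<kappa>_def)
  then have damp: "4 * g * (norm w)\<^sup>2 \<le> - (w \<bullet> U)"
    unfolding wU power2_norm_eq_inner using mult_left_mono[OF lower, of \<kappa>] pos by simp
  have "10 * h * (norm U)\<^sup>2 = 10 * h * \<kappa>\<^sup>2 * (norm (laplacian (W k) *v w))\<^sup>2"
    by (simp add: U_def power_mult_distrib)
  also have "\<dots> \<le> 10 * h * \<kappa>\<^sup>2 * (lamN * (w \<bullet> (laplacian (W k) *v w)))"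
    using upper h by (intro mult_left_mono) auto
  also have "\<dots> = (h / hbar) * - (w \<bullet> U)"
    unfolding wU using pos \<open>0 < hbar\<close> by (simp add: \<kappa>_def power2_eq_square)
  also have "\<dots> \<le> 1 * - (w \<bullet> U)"
    using h \<open>0 < hbar\<close> wU laplacian_nonneg[OF W] pos by (intro mult_right_mono) auto
  finally have small: "10 * h * (norm U)\<^sup>2 \<le> - (w \<bullet> U)" by simp
  have "40 * g * h \<le> 40 * g * hbar" using h pos by (intro mult_left_mono) auto
  also have "\<dots> = lam2 / lamN" using \<open>0 < hbar\<close> by (simp add: g_def)
  also have "\<dots> \<le> 1" using assms pos by simp
  finally have gh: "40 * g * h \<le> 1" .
  have "deviation x 2 s = deviation x 2 (t k) + h *\<^sub>R U"
    "deviation x 1 s = deviation x 1 (t k) + h *\<^sub>R deviation x 2 (t k) + (h\<^sup>2 / 2) *\<^sub>R U"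
    using deviation_sampled[OF traj law W(2) \<open>0 \<le> t k\<close> s] by (simp_all only: U_def w_def h_def)
  moreover have "lyapunov g (deviation x 1 (t k) + h *\<^sub>R deviation x 2 (t k) + (h\<^sup>2 / 2) *\<^sub>R U)
      (deviation x 2 (t k) + h *\<^sub>R U) \<le>
    (1 - g * h / 2) * lyapunov g (deviation x 1 (t k)) (deviation x 2 (t k))"
    by (rule lyapunov_step[OF pos(3) h(1) gh damp[unfolded w_def] small[unfolded w_def]])
  ultimately show ?thesis by (simp only: h_def)
qed

theorem mainTheorem4:
  fixes hbar lam2 lamN :: real
  assumes "hbar > 0" and "0 < lam2" and "lam2 \<le> lamN"
  shows "\<exists>K :: real^2^1.
    \<forall>(t :: nat \<Rightarrow> real) (E :: nat \<Rightarrow> ('n::finite \<times> 'n) set) (W :: nat \<Rightarrow> real^'n^'n).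
      admissible_sampling hbar t \<and>
      (\<forall>k. simple_graph (E k) \<and> weighted_adjacency (E k) (W k) \<and> balanced (W k) \<and>
           has_spanning_tree (E k) \<and>
           (\<forall>\<mu>. eigenvalue (laplacian (W k)) \<mu> \<and> \<mu> \<noteq> 0 \<longrightarrow> \<mu> \<in> {lam2..lamN}))
      \<longrightarrow> solves_consensus dint_A dint_B t (sampled_control_law K t W)"
proof -
  define \<kappa> g where "\<kappa> = 1 / (10 * lamN * hbar)" and "g = lam2 / (40 * lamN * hbar)"
  have "0 < g" using assms by (simp add: g_def)
  have consensus: "solves_consensus dint_A dint_B t (sampled_control_law (gain \<kappa> g) t W)"
    if adm: "admissible_sampling hbar t"
      and graph: "\<And>k. weighted_adjacency (E k) (W k)" "\<And>k. balanced (W k)" "\<And>k. has_spanning_tree (E k)"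
      and ev: "\<And>k \<mu>. eigenvalue (laplacian (W k)) \<mu> \<Longrightarrow> \<mu> \<noteq> 0 \<Longrightarrow> \<mu> \<in> {lam2..lamN}"
    for t and E :: "nat \<Rightarrow> ('n \<times> 'n) set" and W :: "nat \<Rightarrow> real^'n^'n"
    unfolding solves_consensus_def
  proof (intro allI impI)
    fix x0 x u and i j :: 'n
    assume "(\<forall>i. x i 0 = x0 i) \<and> (\<forall>i. agent_trajectory dint_A dint_B t (x i) (u i)) \<and>
      sampled_control_law (gain \<kappa> g) t W x u"
    then have traj: "\<And>i. agent_trajectory dint_A dint_B t (x i) (u i)"
      and law: "sampled_control_law (gain \<kappa> g) t W x u" by auto
    have t: "t 0 = 0" "\<And>k. t k < t (Suc k)" "filterlim t at_top sequentially"
      "\<And>k. t (Suc k) - t k < hbar"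
      using adm unfolding admissible_sampling_def by auto
    have tnn: "0 \<le> t k" for k
      using lift_Suc_mono_le[of t 0 k] t(1,2) by (simp add: less_imp_le)
    define V where "V s = lyapunov g (deviation x 1 s) (deviation x 2 s)" for s
    have Vnn: "0 \<le> V s" for s by (simp add: V_def lyapunov_def)
    have step: "V s \<le> exp (- (g / 2) * (s - t k)) * V (t k)" if s: "s \<in> {t k..t (Suc k)}" for s k
    proof -
      have "V s \<le> (1 - g * (s - t k) / 2) * V (t k)"
        unfolding V_def
        by (rule deviation_lyapunov_step[OF assms \<kappa>_def g_def traj law graph ev tnn t(4) s])
      also have "\<dots> \<le> exp (- (g / 2) * (s - t k)) * V (t k)"
        using exp_ge_add_one_self[of "- (g / 2) * (s - t k)"] Vnn by (intro mult_right_mono) auto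
      finally show ?thesis .
    qed
    \<comment> \<open>The one-step estimate holds inside each interval too, so that no separate bound for the
      motion between the samples is needed.\<close>
    have decay_upto: "\<forall>s\<in>{0..t k}. V s \<le> exp (- (g / 2) * s) * V 0" for k
    proof (induction k)
      case (Suc k)
      show ?case
      proof
        fix s assume s: "s \<in> {0..t (Suc k)}"
        show "V s \<le> exp (- (g / 2) * s) * V 0"
        proof (cases "s \<le> t k")
          case False
          have "V s \<le> exp (- (g / 2) * (s - t k)) * V (t k)"
            using step[of s k] s False by simp
          also have "\<dots> \<le> exp (- (g / 2) * (s - t k)) * (exp (- (g / 2) * t k) * V 0)"
            using Suc tnn[of k] by (intro mult_left_mono) auto
          also have "\<dots> = exp (- (g / 2) * s) * V 0"
            by (simp add: exp_add[symmetric] mult.assoc[symmetric] right_diff_distrib)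
          finally show ?thesis .
        qed (use Suc s in auto)
      qed
    qed (use t(1) in auto)
    have decay: "V s \<le> exp (- (g / 2) * s) * V 0" if "0 \<le> s" for s
    proof -
      have "\<forall>\<^sub>F k in sequentially. s \<le> t k"
        using t(3) unfolding filterlim_at_top by blast
      then obtain k where "s \<le> t k"
        using eventually_happens trivial_limit_sequentially by blast
      then show ?thesis using decay_upto[of k] that by simp
    qed
    have "((\<lambda>s. exp (- (g / 2) * s)) \<longlongrightarrow> 0) at_top"
      using \<open>0 < g\<close>
      by (intro filterlim_compose[OF exp_at_bot] filterlim_tendsto_neg_mult_at_bot[OF tendsto_const]
          filterlim_ident) auto
    then have bound0: "((\<lambda>s. exp (- (g / 2) * s) * V 0) \<longlongrightarrow> 0) at_top"
      by (rule tendsto_mult_left_zero)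
    have "(V \<longlongrightarrow> 0) at_top"
    proof (rule tendsto_sandwich[OF _ _ tendsto_const bound0])
      show "\<forall>\<^sub>F s in at_top. V s \<le> exp (- (g / 2) * s) * V 0"
        using eventually_ge_at_top[of 0] by eventually_elim (rule decay)
    qed (simp add: Vnn)
    then have lim0: "((\<lambda>s. deviation x c s) \<longlongrightarrow> 0) at_top" if "c = 1 \<or> c = 2" for c
      using lyapunov_tendsto_zero[OF \<open>0 < g\<close>, of "deviation x 1" "deviation x 2" at_top] that
      by (auto simp: V_def[abs_def])
    show "((\<lambda>s. x i s - x j s) \<longlongrightarrow> 0) at_top"
    proof (rule vec_tendstoI)
      fix c :: 2
      have "((\<lambda>s. deviation x c s $ i - deviation x c s $ j) \<longlongrightarrow> 0 $ i - 0 $ j) at_top"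
        using lim0[of c] exhaust_2[of c] by (intro tendsto_diff tendsto_vec_nth) auto
      then show "((\<lambda>s. (x i s - x j s) $ c) \<longlongrightarrow> 0 $ c) at_top"
        by (simp add: deviation_def center_nth_diff)
    qed
  qed
  show ?thesis
  proof (rule exI[of _ "gain \<kappa> g"], intro allI impI)
    fix t and E :: "nat \<Rightarrow> ('n \<times> 'n) set" and W :: "nat \<Rightarrow> real^'n^'n"
    assume hyps: "admissible_sampling hbar t \<and>
      (\<forall>k. simple_graph (E k) \<and> weighted_adjacency (E k) (W k) \<and> balanced (W k) \<and>
           has_spanning_tree (E k) \<and>
           (\<forall>\<mu>. eigenvalue (laplacian (W k)) \<mu> \<and> \<mu> \<noteq> 0 \<longrightarrow> \<mu> \<in> {lam2..lamN}))"
    show "solves_consensus dint_A dint_B t (sampled_control_law (gain \<kappa> g) t W)"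
      by (rule consensus[of t E W]) (use hyps in blast)+
  qed
qed

end
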